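(* (Havriliak-Negami model.) Let $\rho>0$, $G_0>0$, $\tau>0$, $0<b\le1$, $0<\alpha<1$, $0<\gamma\le1$, $c_\infty=(G_0/\rho)^{1/2}$, and let $$\kappa(p)=\frac{p}{c_\infty}\left[1-\frac{b}{(1+(\tau p)^\alpha)^\gamma}\right]^{-1/2},\qquad p\in\mathbb{C}\setminus(-\infty,0].$$ For $r>0$ put $$g(r)=\left(1+2(\tau r)^\alpha\cos(\pi\alpha)+(\tau r)^{2\alpha}\right)^{\gamma/2},\qquad f(r)=\arg\left(1+(\tau r)^\alpha e^{i\pi\alpha}\right)\in(0,\pi),$$ $$k(r)=\sqrt{1+b^2/g(r)^2-2b\cos(\gamma f(r))/g(r)},\qquad h(r)=\frac{1}{\pi\sqrt2\,c_\infty}\,\frac{\sqrt{k(r)-1+b\cos(\gamma f(r))/g(r)}}{k(r)}.$$ Then $$\kappa(p)=\frac{p}{c_\infty}+p\int_0^\infty\frac{h(r)\,dr}{p+r}\qquad(p\in\mathbb{C}\setminus(-\infty,0]),$$ and consequently the attenuation and dispersion functions of the Havriliak-Negami model are, for real $\omega\neq0$, $$\mathcal A(\omega)=\omega^2\int_0^\infty\frac{h(r)}{r^2+\omega^2}\,dr,\qquad \mathcal D(\omega)=\omega\int_0^\infty\frac{r\,h(r)}{r^2+\omega^2}\,dr .$$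
   Context: Powers and square roots are principal branches (positive for $p>0$). The Havriliak-Negami model is the viscoelastic model whose relaxation modulus $G$ has Laplace transform $\tilde G(p)=\frac{G_0}{p}\left[1-\frac{b}{(1+(\tau p)^\alpha)^\gamma}\right]$; its complex wave number function is $\kappa(p)=\rho^{1/2}p/Q(p)^{1/2}$ with $Q(p)=p\tilde G(p)$, which gives the displayed $\kappa$. Writing $\kappa(p)=p/c_\infty+\beta(p)$, the attenuation function is $\mathcal A(\omega)=\operatorname{Re}\beta(-i\omega)$ and the dispersion function is $\mathcal D(\omega)=-\operatorname{Im}\beta(-i\omega)$. *)

theory Defs
  imports "HOL-Analysis.Analysis"
begin

text \<open>
  A viscoelastic model is given by the Laplace transform \<open>Gt\<close> of its relaxation modulus, continued
  to the plane cut along \<open>(-\<infinity>, 0]\<close>.  The complex \<open>powr\<close>, \<open>csqrt\<close> and \<open>Arg\<close> are principal branches.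
\<close>

definition complex_modulus :: "(complex \<Rightarrow> complex) \<Rightarrow> complex \<Rightarrow> complex" where
  "complex_modulus Gt p = p * Gt p"

definition wave_number :: "real \<Rightarrow> (complex \<Rightarrow> complex) \<Rightarrow> complex \<Rightarrow> complex" where
  "wave_number \<rho> Gt p = of_real (sqrt \<rho>) * p / csqrt (complex_modulus Gt p)"

definition wave_beta :: "real \<Rightarrow> (complex \<Rightarrow> complex) \<Rightarrow> complex \<Rightarrow> complex" where
  "wave_beta c \<kappa> p = \<kappa> p - p / of_real c"

definition attenuation :: "real \<Rightarrow> (complex \<Rightarrow> complex) \<Rightarrow> real \<Rightarrow> real" where
  "attenuation c \<kappa> \<omega> = Re (wave_beta c \<kappa> (- \<i> * of_real \<omega>))"

definition dispersion :: "real \<Rightarrow> (complex \<Rightarrow> complex) \<Rightarrow> real \<Rightarrow> real" where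
  "dispersion c \<kappa> \<omega> = - Im (wave_beta c \<kappa> (- \<i> * of_real \<omega>))"

definition hn_bracket :: "real \<Rightarrow> real \<Rightarrow> real \<Rightarrow> real \<Rightarrow> complex \<Rightarrow> complex" where
  "hn_bracket b \<tau> \<alpha> \<gamma> p =
     1 - of_real b / (1 + (of_real \<tau> * p) powr of_real \<alpha>) powr of_real \<gamma>"

definition hn_modulus_LT :: "real \<Rightarrow> real \<Rightarrow> real \<Rightarrow> real \<Rightarrow> real \<Rightarrow> complex \<Rightarrow> complex" where
  "hn_modulus_LT G0 b \<tau> \<alpha> \<gamma> p = of_real G0 / p * hn_bracket b \<tau> \<alpha> \<gamma> p"

definition hn_kappa :: "real \<Rightarrow> real \<Rightarrow> real \<Rightarrow> real \<Rightarrow> real \<Rightarrow> complex \<Rightarrow> complex" where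
  "hn_kappa c b \<tau> \<alpha> \<gamma> p = p / of_real c * hn_bracket b \<tau> \<alpha> \<gamma> p powr (- 1 / 2)"

definition hn_g :: "real \<Rightarrow> real \<Rightarrow> real \<Rightarrow> real \<Rightarrow> real" where
  "hn_g \<tau> \<alpha> \<gamma> r =
     (1 + 2 * (\<tau> * r) powr \<alpha> * cos (pi * \<alpha>) + (\<tau> * r) powr (2 * \<alpha>)) powr (\<gamma> / 2)"

definition hn_f :: "real \<Rightarrow> real \<Rightarrow> real \<Rightarrow> real" where
  "hn_f \<tau> \<alpha> r = Arg (1 + of_real ((\<tau> * r) powr \<alpha>) * exp (\<i> * of_real (pi * \<alpha>)))"

definition hn_k :: "real \<Rightarrow> real \<Rightarrow> real \<Rightarrow> real \<Rightarrow> real \<Rightarrow> real" where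
  "hn_k b \<tau> \<alpha> \<gamma> r =
     sqrt (1 + b\<^sup>2 / (hn_g \<tau> \<alpha> \<gamma> r)\<^sup>2 - 2 * b * cos (\<gamma> * hn_f \<tau> \<alpha> r) / hn_g \<tau> \<alpha> \<gamma> r)"

definition hn_h :: "real \<Rightarrow> real \<Rightarrow> real \<Rightarrow> real \<Rightarrow> real \<Rightarrow> real \<Rightarrow> real" where
  "hn_h c b \<tau> \<alpha> \<gamma> r =
     1 / (pi * sqrt 2 * c) *
     (sqrt (hn_k b \<tau> \<alpha> \<gamma> r - 1 + b * cos (\<gamma> * hn_f \<tau> \<alpha> r) / hn_g \<tau> \<alpha> \<gamma> r)
        / hn_k b \<tau> \<alpha> \<gamma> r)"

end

(* In the variable z = log p the cut plane becomes the strip |Im z| < pi, and the two sides of the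
   cut become its two edges.  The function Phi(z) = B(e^z)^(-1/2) - 1, with B the bracket in kappa,
   extends holomorphically to the wider strip |Im z| < pi/alpha because B takes no value in
   (-infinity, 0] there.  The residue theorem for Phi(z) e^z / (e^z - p) on the rectangle
   [-R, R] x [-pi, pi] therefore needs no indentation: the vertical edges vanish as R -> infinity,
   and the horizontal ones combine, by Phi(conj z) = conj (Phi z), into an integral of the jump
   -2 i Im Phi(x + i pi), which is 2 pi i c h(e^x).  Since h >= 0, the case p = 1 together with
   monotone convergence gives the integrability, without asymptotics of h. *)
theory Submission
  imports Defs "HOL-Complex_Analysis.Residue_Theorem"
begin

section \<open>Stieltjes functions from their jump across the cut\<close>

text \<open>The substitution \<open>x = a + (b - a) * t\<close> undoes the parametrization by
  [0, 1]. As integrals over one real interval, the two horizontal edges can be subtracted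
  pointwise.\<close>

lemma contour_integral_linepath_horizontal:
  assumes "a < b" and cont: "continuous_on {a..b} (\<lambda>x. f (Complex x y))"
  shows "contour_integral (linepath (Complex a y) (Complex b y)) f = (LBINT x=a..b. f (Complex x y))"
proof -
  have lp: "linepath (Complex a y) (Complex b y) t = Complex (a + (b - a) * t) y" for t
    by (simp add: linepath_def complex_eq_iff algebra_simps)
  have img: "(\<lambda>t. a + (b - a) * t) ` {0..1} = {a..b}"
    using assms(1) image_affinity_atLeastAtMost[of "b - a" a 0 1] by (simp add: add.commute)
  have "contour_integral (linepath (Complex a y) (Complex b y)) f =
     integral {0..1} (\<lambda>t. (b - a) *\<^sub>R f (Complex (a + (b - a) * t) y))"
    by (simp add: contour_integral_integral lp scaleR_conv_of_real mult.commute
        complex_eq_iff flip: of_real_diff)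
  also have "\<dots> = (LBINT t=0..1. (b - a) *\<^sub>R f (Complex (a + (b - a) * t) y))"
  proof -
    have "continuous_on {0..1} (\<lambda>t. (b - a) *\<^sub>R f (Complex (a + (b - a) * t) y))"
      by (intro continuous_intros continuous_on_compose2[OF cont]) (use img in auto)
    then show ?thesis
      unfolding zero_ereal_def one_ereal_def
      by (intro interval_integral_eq_integral[symmetric] borel_integrable_atLeastAtMost') auto
  qed
  also have "\<dots> = (LBINT x=a..b. f (Complex x y))"
  proof -
    have "((\<lambda>t. a + (b - a) * t) has_real_derivative b - a) (at t within {0..1})" for t
      by (auto intro!: derivative_eq_intros)
    from interval_integral_substitution_finite[OF _ this, where f = "\<lambda>x. f (Complex x y)"] cont
    show ?thesis
      unfolding img zero_ereal_def one_ereal_def by simp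
  qed
  finally show ?thesis .
qed

text \<open>Two logarithms of one number differ by a multiple of 2 pi i, and the bound leaves only
  the multiple 0. This makes \<open>w\<close> the only pole of \<open>1 / (exp u - exp w)\<close> in
  a strip of half-width \<open>2 * pi - \<bar>Im w\<bar>\<close>.\<close>

lemma exp_inj_narrow_strip:
  fixes u w :: complex
  assumes "exp u = exp w" "\<bar>Im u\<bar> < 2 * pi - \<bar>Im w\<bar>"
  shows "u = w"
proof -
  obtain n :: int where n: "u = w + of_int (2 * n) * of_real pi * \<i>"
    using assms(1) by (auto simp: exp_eq)
  then have "Im u = Im w + 2 * of_int n * pi" by simp
  then have "\<bar>2 * of_int n * pi\<bar> < 2 * pi" using assms(2) by linarith
  then have "\<bar>of_int n :: real\<bar> < 1" by (simp add: abs_mult)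
  then have "n = 0" by linarith
  then show ?thesis using n by simp
qed

section \<open>Residues and boundary integrals on rectangles of height 2 pi\<close>

text \<open>The only pole inside is \<open>w\<close>. Near it \<open>exp u - exp w\<close> behaves
  like \<open>exp w * (u - w)\<close>, so \<open>exp u / (exp u - exp w)\<close> has residue 1 and
  the residue of the product is \<open>\<Phi> w\<close>.\<close>

lemma Residue_theorem_strip_rectangle:
  fixes \<Phi> :: "complex \<Rightarrow> complex"
  assumes d: "pi < d" and holo: "\<Phi> holomorphic_on {z. \<bar>Im z\<bar> < d}"
    and w: "\<bar>Im w\<bar> < pi" and R: "\<bar>Re w\<bar> < R"
  shows "contour_integral (rectpath (Complex (-R) (-pi)) (Complex R pi))
           (\<lambda>u. \<Phi> u * exp u / (exp u - exp w)) = 2 * pi * \<i> * \<Phi> w"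
proof -
  \<comment> \<open>Both bounds on \<open>\<bar>Im z\<bar>\<close> exceed pi, so the open strip
    \<open>S\<close> contains the closed rectangle; the first keeps it in the domain of
    \<open>\<Phi>\<close>, the second excludes the other solutions of
    \<open>exp u = exp w\<close>.\<close>
  define S where "S = {z. \<bar>Im z\<bar> < min d (2 * pi - \<bar>Im w\<bar>)}"
  define H where "H = (\<lambda>u. \<Phi> u * exp u / (exp u - exp w))"
  let ?g = "rectpath (Complex (-R) (-pi)) (Complex R pi)"
  have S_eq: "S = Im -` {- min d (2 * pi - \<bar>Im w\<bar>) <..< min d (2 * pi - \<bar>Im w\<bar>)}"
    by (auto simp: S_def)
  have opS: "open S" 
    unfolding S_eq by (intro open_vimage continuous_intros)
  have "convex S"
    unfolding S_eq by (intro convex_linear_vimage bounded_linear.linear[OF bounded_linear_Im]) auto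
  then have conS: "connected S" by (rule convex_connected)
  have nz: "exp u - exp w \<noteq> 0" if "u \<in> S - {w}" for u
    using exp_inj_narrow_strip[of u w] that by (auto simp: S_def)
  have holoH: "H holomorphic_on (S - {w})"
    unfolding H_def using nz
    by (intro holomorphic_intros holomorphic_on_subset[OF holo]) (auto simp: S_def)
  have wS: "w \<in> S" using w d by (auto simp: S_def)
  have img: "path_image ?g \<subseteq> S - {w}"
  proof -
    have "path_image ?g \<subseteq> S"
      using path_image_rectpath_subset_cbox[of "Complex (-R) (-pi)" "Complex R pi"] R d w
      by (fastforce simp: in_cbox_complex_iff S_def)
    moreover have "w \<notin> path_image ?g"
      using R w by (auto simp: path_image_rectpath)
    ultimately show ?thesis by blast
  qed
  have "contour_integral ?g H = 2 * pi * \<i> * (\<Sum>p\<in>{w}. winding_number ?g p * residue H p)"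
  proof (rule Residue_theorem[OF opS conS _ holoH])
    show "\<forall>z. z \<notin> S \<longrightarrow> winding_number ?g z = 0"
    proof (intro allI impI winding_number_rectpath_outside)
      fix z assume "z \<notin> S"
      then show "z \<notin> cbox (Complex (-R) (-pi)) (Complex R pi)"
        using d w by (fastforce simp: in_cbox_complex_iff S_def)
    qed (use R in auto)
  qed (use img in auto)
  moreover have "winding_number ?g w = 1"
    by (rule winding_number_rectpath) (use R w in \<open>auto simp: in_box_complex_iff\<close>)
  moreover have "residue H w = \<Phi> w"
  proof (rule residue_simple'[OF opS wS holoH])
    have "isCont \<Phi> w"
      using holo opS wS
      by (intro holomorphic_on_imp_continuous_on[THEN continuous_on_interior, of _ S]
           holomorphic_on_subset[OF holo]) (auto simp: S_def interior_open)
    moreover have "((\<lambda>u. (exp u - exp w) / (u - w)) \<longlongrightarrow> exp w) (at w)"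
      using DERIV_exp[of w] by (simp add: has_field_derivative_iff)
    ultimately have "((\<lambda>u. \<Phi> u * exp u / ((exp u - exp w) / (u - w))) \<longlongrightarrow> \<Phi> w * exp w / exp w) (at w)"
      by (intro tendsto_intros) (auto simp: isCont_def)
    then show "((\<lambda>u. H u * (u - w)) \<longlongrightarrow> \<Phi> w) (at w)"
      by (simp add: H_def)
  qed
  ultimately show ?thesis by (simp add: H_def)
qed

text \<open>Limits along this filter and its left counterpart are uniform in \<open>Im z\<close>
  over [-pi, pi], which is what an estimate on a whole vertical edge needs.\<close>

abbreviation right_end :: "complex filter" where
  "right_end \<equiv> inf (filtercomap Re at_top) (principal {z. \<bar>Im z\<bar> \<le> pi})"

abbreviation left_end :: "complex filter" where
  "left_end \<equiv> inf (filtercomap Re at_bot) (principal {z. \<bar>Im z\<bar> \<le> pi})"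

lemma eventually_right_end:
  "eventually P right_end \<longleftrightarrow> (\<exists>K. \<forall>z. Re z \<ge> K \<longrightarrow> \<bar>Im z\<bar> \<le> pi \<longrightarrow> P z)"
  by (auto simp: eventually_inf_principal eventually_filtercomap_at_top_linorder)

lemma eventually_left_end:
  "eventually P left_end \<longleftrightarrow> (\<exists>K. \<forall>z. Re z \<le> K \<longrightarrow> \<bar>Im z\<bar> \<le> pi \<longrightarrow> P z)"
  by (auto simp: eventually_inf_principal eventually_filtercomap_at_bot_linorder)

text \<open>The edge has constant length 2 pi, so a uniform bound on the integrand suffices. The
  function \<open>s\<close> allows one proof for the right edge at R and the left edge at
  -R.\<close>

lemma contour_integral_vertical_tendsto_0:
  fixes H :: "complex \<Rightarrow> complex"
  assumes ev: "\<And>e. e > 0 \<Longrightarrow> eventually (\<lambda>x. \<forall>y. \<bar>y\<bar> \<le> pi \<longrightarrow> norm (H (Complex (s x) y)) \<le> e) F"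
    and cont: "eventually (\<lambda>x. continuous_on (closed_segment (Complex (s x) (-pi)) (Complex (s x) pi)) H) F"
  shows "((\<lambda>x. contour_integral (linepath (Complex (s x) (-pi)) (Complex (s x) pi)) H) \<longlongrightarrow> 0) F"
proof (rule tendstoI)
  fix e :: real assume "e > 0"
  \<comment> \<open>Multiplied by the length 2 pi this gives \<open>e / 2\<close>, hence a strict
    bound by \<open>e\<close>.\<close>
  then have e': "e / (4 * pi) > 0" by simp
  show "\<forall>\<^sub>F x in F. dist (contour_integral (linepath (Complex (s x) (-pi)) (Complex (s x) pi)) H) 0 < e"
    using ev[OF e'] cont
  proof eventually_elim
    case (elim x)
    let ?a = "Complex (s x) (-pi)" and ?b = "Complex (s x) pi"
    have "norm (contour_integral (linepath ?a ?b) H) \<le> e / (4 * pi) * norm (?b - ?a)"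
    proof (rule contour_integral_bound_linepath)
      show "H contour_integrable_on linepath ?a ?b"
        using elim(2) by (rule contour_integrable_continuous_linepath)
      fix z assume "z \<in> closed_segment ?a ?b"
      then have "Re z = s x" "\<bar>Im z\<bar> \<le> pi"
        by (auto simp: closed_segment_same_Re closed_segment_eq_real_ivl)
      then show "norm (H z) \<le> e / (4 * pi)"
        using elim(1)[rule_format, of "Im z"] by (metis complex_surj)
    qed (use e' in auto)
    also have "?b - ?a = of_real (2 * pi) * \<i>" by (simp add: complex_eq_iff)
    also have "e / (4 * pi) * norm (of_real (2 * pi) * \<i>) = e / 2" by (simp add: norm_mult)
    finally show ?case using \<open>e > 0\<close> by simp
  qed
qed

text \<open>This is a statement about symmetric truncations only: the vertical edges are the error
  terms and tend to 0. Absolute integrability is not claimed here; it is obtained later from the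
  sign of the density.\<close>

lemma jump_integral_tendsto:
  fixes \<Phi> :: "complex \<Rightarrow> complex"
  assumes d: "pi < d" and holo: "\<Phi> holomorphic_on {z. \<bar>Im z\<bar> < d}"
    and cnj: "\<And>z. \<bar>Im z\<bar> < d \<Longrightarrow> \<Phi> (cnj z) = cnj (\<Phi> z)"
    and right: "(\<Phi> \<longlongrightarrow> 0) right_end"
    and left: "((\<lambda>z. exp z * \<Phi> z) \<longlongrightarrow> 0) left_end"
    and w: "\<bar>Im w\<bar> < pi"
  shows "((\<lambda>R. LBINT x=ereal (-R)..ereal R. of_real (- Im (\<Phi> (Complex x pi)) / pi * exp x) / (exp w + of_real (exp x)))
            \<longlongrightarrow> \<Phi> w) at_top"
proof -
  define H where "H = (\<lambda>u. \<Phi> u * exp u / (exp u - exp w))"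
  have contH: "continuous_on A H" if "A \<subseteq> {z. \<bar>Im z\<bar> \<le> pi}" "\<And>u. u \<in> A \<Longrightarrow> exp u \<noteq> exp w" for A
    unfolding H_def using that d
    by (intro continuous_intros continuous_on_subset[OF holomorphic_on_imp_continuous_on[OF holo]]) force+
  \<comment> \<open>Vertical edges away from \<open>Re w\<close> are separated from the poles by the
    modulus of \<open>exp\<close>, horizontal ones by injectivity in the strip.\<close>
  have exp_ne: "exp u \<noteq> exp w" if "Re u \<noteq> Re w \<or> \<bar>Im u\<bar> = pi" for u
  proof
    assume eq: "exp u = exp w"
    then have "exp (Re u) = exp (Re w)" by (metis norm_exp_eq_Re)
    moreover have "u = w" if "\<bar>Im u\<bar> = pi"
      by (rule exp_inj_narrow_strip[OF eq]) (use w that in auto)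
    ultimately show False using that w by auto
  qed
  have H_right: "(H \<longlongrightarrow> 0) right_end"
  proof -
    have "filterlim Re at_top right_end"
      by (rule filterlim_mono[OF filterlim_filtercomap]) auto
    then have "filterlim (\<lambda>u. norm (exp u)) at_top right_end"
      unfolding norm_exp_eq_Re by (rule filterlim_compose[OF exp_at_top])
    then have "((\<lambda>u. inverse (exp u :: complex)) \<longlongrightarrow> 0) right_end"
      by (intro filterlim_compose[OF tendsto_inverse_0] filterlim_norm_at_top_imp_at_infinity)
    \<comment> \<open>Cancelling \<open>exp u\<close> leaves a denominator tending to 1, so decay of
      \<open>\<Phi>\<close> itself suffices on the right.\<close>
    then have "((\<lambda>u. \<Phi> u / (1 - exp w * inverse (exp u))) \<longlongrightarrow> 0 / (1 - exp w * 0)) right_end"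
      by (intro tendsto_intros right) auto
    moreover have "\<Phi> u / (1 - exp w * inverse (exp u)) = H u" for u
    proof -
      have "exp u - exp w = exp u * (1 - exp w * inverse (exp u))" by (simp add: field_simps)
      then show ?thesis by (simp add: H_def)
    qed
    ultimately show ?thesis by simp
  qed
  have H_left: "(H \<longlongrightarrow> 0) left_end"
  proof -
    have "filterlim Re at_bot left_end"
      by (rule filterlim_mono[OF filterlim_filtercomap]) auto
    then have "((\<lambda>u. norm (exp u :: complex)) \<longlongrightarrow> 0) left_end"
      unfolding norm_exp_eq_Re by (rule filterlim_compose[OF exp_at_bot])
    then have "((\<lambda>u. exp u :: complex) \<longlongrightarrow> 0) left_end"
      by (rule tendsto_norm_zero_cancel)
    \<comment> \<open>Here the denominator tends to \<open>- exp w\<close>, which is not 0. The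
      factor \<open>exp u\<close> stays in the numerator, so \<open>\<Phi>\<close> may be unbounded
      on the left.\<close>
    then have "((\<lambda>u. (exp u * \<Phi> u) / (exp u - exp w)) \<longlongrightarrow> 0 / (0 - exp w)) left_end"
      by (intro tendsto_intros left) auto
    then show ?thesis by (simp add: H_def mult.commute)
  qed
  have R: "((\<lambda>R. contour_integral (linepath (Complex R (-pi)) (Complex R pi)) H) \<longlongrightarrow> 0) at_top"
  proof (rule contour_integral_vertical_tendsto_0)
    fix e :: real assume "e > 0"
    then have "\<forall>\<^sub>F z in right_end. norm (H z) < e"
      using tendstoD[OF H_right] by simp
    then obtain K where "\<forall>z. Re z \<ge> K \<longrightarrow> \<bar>Im z\<bar> \<le> pi \<longrightarrow> norm (H z) < e"
      unfolding eventually_right_end by blast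
    then show "\<forall>\<^sub>F x in at_top. \<forall>y. \<bar>y\<bar> \<le> pi \<longrightarrow> norm (H (Complex x y)) \<le> e"
      by (auto simp: eventually_at_top_linorder less_imp_le intro!: exI[of _ K])
  next
    show "\<forall>\<^sub>F R in at_top. continuous_on (closed_segment (Complex R (-pi)) (Complex R pi)) H"
      using eventually_gt_at_top[of "Re w"]
      by eventually_elim
         (intro contH exp_ne; auto simp: closed_segment_same_Re closed_segment_eq_real_ivl)
  qed
  have L: "((\<lambda>R. contour_integral (linepath (Complex (-R) (-pi)) (Complex (-R) pi)) H) \<longlongrightarrow> 0) at_top"
  proof (rule contour_integral_vertical_tendsto_0)
    fix e :: real assume "e > 0"
    then have "\<forall>\<^sub>F z in left_end. norm (H z) < e"
      using tendstoD[OF H_left] by simp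
    then obtain K where "\<forall>z. Re z \<le> K \<longrightarrow> \<bar>Im z\<bar> \<le> pi \<longrightarrow> norm (H z) < e"
      unfolding eventually_left_end by blast
    then show "\<forall>\<^sub>F x in at_top. \<forall>y. \<bar>y\<bar> \<le> pi \<longrightarrow> norm (H (Complex (-x) y)) \<le> e"
      by (auto simp: eventually_at_top_linorder less_imp_le intro!: exI[of _ "-K"])
  next
    show "\<forall>\<^sub>F R in at_top. continuous_on (closed_segment (Complex (-R) (-pi)) (Complex (-R) pi)) H"
      using eventually_gt_at_top[of "- Re w"]
      by eventually_elim
         (intro contH exp_ne; auto simp: closed_segment_same_Re closed_segment_eq_real_ivl)
  qed
  let ?J = "\<lambda>R. LBINT x=ereal (-R)..ereal R. of_real (- Im (\<Phi> (Complex x pi)) / pi * exp x) / (exp w + of_real (exp x))"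
  \<comment> \<open>Once the rectangle encloses \<open>w\<close>, the residue theorem is an exact
    identity: only the two vertical edges separate the truncated integral from
    \<open>\<Phi> w\<close>.\<close>
  have main: "?J R = \<Phi> w -
      (contour_integral (linepath (Complex R (-pi)) (Complex R pi)) H
       - contour_integral (linepath (Complex (-R) (-pi)) (Complex (-R) pi)) H) / (2 * pi * \<i>)"
    if R: "\<bar>Re w\<bar> < R" for R
  proof -
    let ?a1 = "Complex (-R) (-pi)" and ?a2 = "Complex R (-pi)"
      and ?a3 = "Complex R pi" and ?a4 = "Complex (-R) pi"
    have seg: "continuous_on (closed_segment ?a1 ?a2) H" "continuous_on (closed_segment ?a2 ?a3) H"
       "continuous_on (closed_segment ?a4 ?a3) H" "continuous_on (closed_segment ?a1 ?a4) H"
      using R by (intro contH exp_ne;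
          auto simp: closed_segment_same_Re closed_segment_same_Im closed_segment_eq_real_ivl)+
    then have int: "H contour_integrable_on linepath ?a1 ?a2" "H contour_integrable_on linepath ?a2 ?a3"
       "H contour_integrable_on linepath ?a3 ?a4" "H contour_integrable_on linepath ?a4 ?a1"
      by (auto intro!: contour_integrable_continuous_linepath simp: closed_segment_commute)
    have "2 * pi * \<i> * \<Phi> w = contour_integral (rectpath ?a1 ?a3) H"
      unfolding H_def using Residue_theorem_strip_rectangle[OF d holo w R] by simp
    also have "\<dots> = contour_integral (linepath ?a1 ?a2) H + contour_integral (linepath ?a2 ?a3) H
         - contour_integral (linepath ?a4 ?a3) H - contour_integral (linepath ?a1 ?a4) H"
      using int contour_integral_reverse_linepath[OF seg(3)] contour_integral_reverse_linepath[OF seg(4)]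
      by (simp add: rectpath_def Let_def contour_integrable_joinI valid_path_join)
    finally have eq: "2 * pi * \<i> * \<Phi> w = \<dots>" .
    have ch: "continuous_on {-R..R} (\<lambda>x. H (Complex x y))" if "\<bar>y\<bar> = pi" for y
      by (rule continuous_on_compose2[OF contH[of "{z. \<bar>Im z\<bar> = pi}"]])
         (use that exp_ne in \<open>auto intro!: continuous_intros simp: Complex_eq\<close>)
    have i: "interval_lebesgue_integrable lborel (-R) R (\<lambda>x. H (Complex x y))" if "\<bar>y\<bar> = pi" for y
      by (intro interval_integrable_continuous_on ch that) (use R in auto)
    have "contour_integral (linepath ?a1 ?a2) H - contour_integral (linepath ?a4 ?a3) H =
        (LBINT x=ereal (-R)..ereal R. H (Complex x (-pi)) - H (Complex x pi))"
      using R i[of pi] i[of "-pi"] ch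
      by (subst (1 2) contour_integral_linepath_horizontal) auto
    also have "\<dots> = (LBINT x=ereal (-R)..ereal R. (2 * pi * \<i>) *
       (of_real (- Im (\<Phi> (Complex x pi)) / pi * exp x) / (exp w + of_real (exp x))))"
    proof (rule interval_integral_cong)
      fix x
      \<comment> \<open>Both edges lie over the same point \<open>- exp x\<close> of the cut, so the
        kernel agrees on them and the difference comes from \<open>\<Phi>\<close> alone.\<close>
      have e: "exp (Complex x pi) = - of_real (exp x)" "exp (Complex x (-pi)) = - of_real (exp x)"
        by (simp_all add: exp_eq_polar complex_eq_iff)
      have c: "\<Phi> (Complex x (-pi)) = cnj (\<Phi> (Complex x pi))"
        using cnj[of "Complex x pi"] d by (simp add: complex_cnj)
      have "\<Phi> (Complex x (-pi)) - \<Phi> (Complex x pi) = - (2 * \<i> * of_real (Im (\<Phi> (Complex x pi))))"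
        unfolding c by (simp add: complex_eq_iff)
      moreover have "H (Complex x (-pi)) - H (Complex x pi) =
          (\<Phi> (Complex x (-pi)) - \<Phi> (Complex x pi)) * of_real (exp x) / (exp w + of_real (exp x))"
      proof -
        have "a * - E / (- E - W) - b * - E / (- E - W) = (a - b) * E / (W + E)" for a b E W :: complex
        proof -
          have "- E - W = - (W + E)" by simp
          then show ?thesis by (simp only: mult_minus_right minus_divide_divide)
            (simp add: algebra_simps diff_divide_distrib)
        qed
        then show ?thesis unfolding H_def e .
      qed
      ultimately show "H (Complex x (-pi)) - H (Complex x pi) = (2 * pi * \<i>) *
       (of_real (- Im (\<Phi> (Complex x pi)) / pi * exp x) / (exp w + of_real (exp x)))"
        by simp
    qed
    finally have "contour_integral (linepath ?a1 ?a2) H - contour_integral (linepath ?a4 ?a3) H = 2 * pi * \<i> * ?J R"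
      by (simp only: interval_lebesgue_integral_mult_right)
    with eq show ?thesis by (simp add: field_simps)
  qed
  have "((\<lambda>R. \<Phi> w -
      (contour_integral (linepath (Complex R (-pi)) (Complex R pi)) H
       - contour_integral (linepath (Complex (-R) (-pi)) (Complex (-R) pi)) H) / (2 * pi * \<i>))
      \<longlongrightarrow> \<Phi> w - (0 - 0) / (2 * pi * \<i>)) at_top"
    by (intro tendsto_intros R L) auto
  moreover have "\<forall>\<^sub>F R in at_top. \<Phi> w -
      (contour_integral (linepath (Complex R (-pi)) (Complex R pi)) H
       - contour_integral (linepath (Complex (-R) (-pi)) (Complex (-R) pi)) H) / (2 * pi * \<i>) = ?J R"
    using eventually_gt_at_top[of "\<bar>Re w\<bar>"] by eventually_elim (simp only: main)
  ultimately show ?thesis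
    using Lim_transform_eventually by fastforce
qed


section \<open>From truncations to an absolutely convergent integral\<close>

text \<open>Compares the kernel at \<open>p\<close> with the kernel at 1, so that integrability at
  the single point 1 carries over to the whole cut plane.\<close>

lemma cut_kernel_bound:
  fixes p :: complex
  assumes "p \<notin> \<real>\<^sub>\<le>\<^sub>0"
  obtains C where "C > 0" "\<And>r. r > 0 \<Longrightarrow> norm (1 / (p + of_real r)) \<le> C / (1 + r)"
proof -
  have "open (- \<real>\<^sub>\<le>\<^sub>0 :: complex set)" by (simp add: open_Compl)
  then obtain \<delta> where \<delta>: "\<delta> > 0" "ball p \<delta> \<subseteq> - \<real>\<^sub>\<le>\<^sub>0"
    using assms by (metis ComplI open_contains_ball)
  \<comment> \<open>From \<open>1 + r \<le> (1 + norm p) + norm (p + of_real r)\<close> and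
    \<open>\<delta> \<le> norm (p + of_real r)\<close>, the first summand costs
    \<open>(1 + norm p) / \<delta>\<close> and the second costs 1.\<close>
  define C where "C = (1 + norm p) / \<delta> + 1"
  have C: "C > 0" using \<delta> by (auto simp: C_def intro!: add_nonneg_pos)
  have "norm (1 / (p + of_real r)) \<le> C / (1 + r)" if r: "r > 0" for r
  proof -
    have "- of_real r \<in> (\<real>\<^sub>\<le>\<^sub>0 :: complex set)"
      using r by (simp add: complex_nonpos_Reals_iff)
    then have "- of_real r \<notin> ball p \<delta>" using \<delta> by blast
    then have 1: "\<delta> \<le> norm (p + of_real r)" by (simp add: dist_norm)
    have "r \<le> norm p + norm (p + of_real r)"
      using norm_triangle_ineq4[of "p + of_real r" p] r by simp
    moreover have "1 + norm p \<le> (1 + norm p) / \<delta> * norm (p + of_real r)"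
      using mult_left_mono[OF 1, of "(1 + norm p) / \<delta>"] \<delta> by simp
    ultimately have "1 + r \<le> C * norm (p + of_real r)"
      by (simp add: C_def algebra_simps)
    moreover have "norm (p + of_real r) > 0" using 1 \<delta> by linarith
    ultimately show ?thesis
      using r by (simp add: norm_divide field_simps)
  qed
  with C show ?thesis using that by blast
qed

text \<open>The substitution \<open>r = exp x\<close> turns the symmetric truncations into integrals
  over \<open>[l i, u i]\<close> with limit \<open>\<Phi> (Ln q)\<close>. Positivity at q = 1 yields
  integrability, the kernel bound transfers it to \<open>p\<close>, and the integral over the
  half-line is then the limit of its truncations.\<close>

theorem Stieltjes_representation:
  fixes \<Phi> :: "complex \<Rightarrow> complex" and \<mu> :: "real \<Rightarrow> real"
  assumes d: "pi < d" and holo: "\<Phi> holomorphic_on {z. \<bar>Im z\<bar> < d}"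
    and cnj: "\<And>z. \<bar>Im z\<bar> < d \<Longrightarrow> \<Phi> (cnj z) = cnj (\<Phi> z)"
    and right: "(\<Phi> \<longlongrightarrow> 0) right_end"
    and left: "((\<lambda>z. exp z * \<Phi> z) \<longlongrightarrow> 0) left_end"
    and \<mu>: "\<And>r. r > 0 \<Longrightarrow> \<mu> r = - Im (\<Phi> (Complex (ln r) pi)) / pi"
    and nonneg: "\<And>r. r > 0 \<Longrightarrow> \<mu> r \<ge> 0"
    and p: "p \<notin> \<real>\<^sub>\<le>\<^sub>0"
  shows "set_integrable lborel {0<..} (\<lambda>r. of_real (\<mu> r) / (p + of_real r))"
    and "(LINT r:{0<..}|lborel. of_real (\<mu> r) / (p + of_real r)) = \<Phi> (Ln p)"
proof -
  have cont: "continuous_on {0<..} \<mu>"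
  proof -
    have "continuous_on {0<..} (\<lambda>r. - Im (\<Phi> (Complex (ln r) pi)) / pi)"
      unfolding Complex_eq using d
      by (intro continuous_intros continuous_on_compose2[OF holomorphic_on_imp_continuous_on[OF holo]]) auto
    then show ?thesis using \<mu> by (subst continuous_on_cong[OF refl]) auto
  qed
  have nz: "q + of_real r \<noteq> 0" if "q \<notin> \<real>\<^sub>\<le>\<^sub>0" "r > 0" for q :: complex and r
    using that by (auto simp: complex_nonpos_Reals_iff complex_eq_iff)
  have contk: "continuous_on {0<..} (\<lambda>r. of_real (\<mu> r) / (q + of_real r))"
    if "q \<notin> \<real>\<^sub>\<le>\<^sub>0" for q :: complex
    by (intro continuous_intros cont) (use nz that in auto)
  \<comment> \<open>The images of the endpoints of [-(i+1), i+1] under \<open>exp\<close>; the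
    successor makes \<open>l i < u i\<close> strict already for i = 0.\<close>
  define u l where "u = (\<lambda>i::nat. exp (real (Suc i)))" and "l = (\<lambda>i::nat. exp (- real (Suc i)))"
  have u_top: "filterlim u at_top sequentially"
    unfolding u_def
    by (intro filterlim_compose[OF exp_at_top] filterlim_compose[OF filterlim_real_sequentially filterlim_Suc])
  have l_0: "l \<longlonglongrightarrow> 0"
    unfolding l_def
    by (intro filterlim_compose[OF exp_at_bot] filterlim_compose[OF filterlim_uminus_at_bot_at_top]
       filterlim_compose[OF filterlim_real_sequentially filterlim_Suc])
  have approx: "einterval 0 \<infinity> = (\<Union>i. {l i .. u i})" "incseq u" "decseq l" "\<And>i. l i < u i"
     "\<And>i. 0 < ereal (l i)" "\<And>i. ereal (u i) < \<infinity>"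
     "(\<lambda>i. ereal (l i)) \<longlonglongrightarrow> 0" "(\<lambda>i. ereal (u i)) \<longlonglongrightarrow> \<infinity>"
  proof -
    show "einterval 0 \<infinity> = (\<Union>i. {l i .. u i})"
    proof safe
      fix x assume "x \<in> einterval 0 \<infinity>"
      then have x: "x > 0" by (simp add: einterval_iff)
      have "\<forall>\<^sub>F i in sequentially. l i < x \<and> x < u i"
        using order_tendstoD(2)[OF l_0 x] u_top[unfolded filterlim_at_top_dense, rule_format, of x]
        by eventually_elim auto
      then obtain i where "l i < x \<and> x < u i"
        by (auto simp: eventually_sequentially)
      then have "x \<in> {l i..u i}" by simp
      then show "x \<in> (\<Union>i. {l i .. u i})" by blast
    next
      fix x i assume "x \<in> {l i..u i}"
      moreover have "l i > 0" by (simp add: l_def)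
      ultimately show "x \<in> einterval 0 \<infinity>" by (simp add: einterval_iff)
    qed
    show "(\<lambda>i. ereal (l i)) \<longlonglongrightarrow> 0" using l_0 by (simp add: zero_ereal_def)
    show "(\<lambda>i. ereal (u i)) \<longlonglongrightarrow> \<infinity>"
      using u_top by (simp add: tendsto_PInfty_eq_at_top)
  qed (auto simp: u_def l_def incseq_def decseq_def)
  have lim: "(\<lambda>i. LBINT r=l i..u i. of_real (\<mu> r) / (q + of_real r)) \<longlonglongrightarrow> \<Phi> (Ln q)"
    if q: "q \<notin> \<real>\<^sub>\<le>\<^sub>0" for q :: complex
  proof -
    have q0: "q \<noteq> 0" using q by auto
    have "\<bar>Im (Ln q)\<bar> < pi"
      using Im_Ln_less_pi[OF q] mpi_less_Im_Ln[OF q0] by simp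
    then have jump: "((\<lambda>R. LBINT x=ereal (-R)..ereal R. of_real (- Im (\<Phi> (Complex x pi)) / pi * exp x)
          / (exp (Ln q) + of_real (exp x))) \<longlongrightarrow> \<Phi> (Ln q)) at_top"
      by (intro jump_integral_tendsto[OF d holo _ right left] cnj)
    have "(\<lambda>i. LBINT x=ereal (-real (Suc i))..ereal (real (Suc i)). of_real (- Im (\<Phi> (Complex x pi)) / pi * exp x) / (exp (Ln q) + of_real (exp x)))
      \<longlonglongrightarrow> \<Phi> (Ln q)"
      by (rule filterlim_compose[OF jump filterlim_compose[OF filterlim_real_sequentially filterlim_Suc]])
    also have "(\<lambda>i. LBINT x=ereal (-real (Suc i))..ereal (real (Suc i)). of_real (- Im (\<Phi> (Complex x pi)) / pi * exp x) / (exp (Ln q) + of_real (exp x)))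
       = (\<lambda>i. LBINT r=l i..u i. of_real (\<mu> r) / (q + of_real r))"
    proof
      fix i
      have "(LBINT x=ereal (-real (Suc i))..ereal (real (Suc i)). of_real (- Im (\<Phi> (Complex x pi)) / pi * exp x) / (exp (Ln q) + of_real (exp x)))
        = (LBINT x=ereal (-real (Suc i))..ereal (real (Suc i)). exp x *\<^sub>R (of_real (\<mu> (exp x)) / (q + of_real (exp x))))"
        by (rule interval_integral_cong) (use q0 in \<open>simp add: \<mu> scaleR_conv_of_real\<close>)
      also have "\<dots> = (LBINT r=exp (-real (Suc i))..exp (real (Suc i)). of_real (\<mu> r) / (q + of_real r))"
        by (rule interval_integral_substitution_finite)
           (auto intro!: derivative_eq_intros continuous_intros continuous_on_subset[OF contk[OF q]])
      finally show "(LBINT x=ereal (-real (Suc i))..ereal (real (Suc i)). of_real (- Im (\<Phi> (Complex x pi)) / pi * exp x) / (exp (Ln q) + of_real (exp x)))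
        = (LBINT r=l i..u i. of_real (\<mu> r) / (q + of_real r))"
        by (simp add: u_def l_def)
    qed
    finally show ?thesis .
  qed
  \<comment> \<open>At q = 1 the integrand is real and nonnegative, so convergence of its truncated
    integrals already forces integrability over the half-line.\<close>
  have int1: "set_integrable lborel {0<..} (\<lambda>r. \<mu> r / (1 + r))"
  proof -
    have "set_integrable lborel (einterval 0 \<infinity>) (\<lambda>r. \<mu> r / (1 + r))"
    proof (rule interval_integral_Icc_approx_nonneg[OF _ approx])
      show "set_integrable lborel {l i..u i} (\<lambda>r. \<mu> r / (1 + r))" for i
      proof (rule borel_integrable_atLeastAtMost')
        have "l i > 0" by (simp add: l_def)
        then show "continuous_on {l i..u i} (\<lambda>r. \<mu> r / (1 + r))"
          by (intro continuous_intros continuous_on_subset[OF cont]) auto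
      qed
      show "set_borel_measurable lborel (einterval 0 \<infinity>) (\<lambda>r. \<mu> r / (1 + r))"
      proof -
        have "set_borel_measurable borel {0<..} (\<lambda>r. \<mu> r / (1 + r))"
          by (intro set_measurable_continuous_on continuous_intros cont) auto
        then show ?thesis by (simp add: set_borel_measurable_def zero_ereal_def)
      qed
      have "(\<lambda>i. Re (LBINT r=l i..u i. of_real (\<mu> r) / (1 + of_real r))) \<longlonglongrightarrow> Re (\<Phi> (Ln 1))"
        by (intro tendsto_intros lim) auto
      also have "(\<lambda>i. Re (LBINT r=l i..u i. of_real (\<mu> r) / (1 + of_real r))) = (\<lambda>i. LBINT r=l i..u i. \<mu> r / (1 + r))"
      proof
        fix i
        have "(LBINT r=l i..u i. complex_of_real (\<mu> r) / (1 + of_real r)) = of_real (LBINT r=l i..u i. \<mu> r / (1 + r))"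
          by (subst interval_lebesgue_integral_of_real[symmetric]) simp
        then show "Re (LBINT r=l i..u i. of_real (\<mu> r) / (1 + of_real r)) = (LBINT r=l i..u i. \<mu> r / (1 + r))"
          by simp
      qed
      finally show "(\<lambda>i. LBINT r=l i..u i. \<mu> r / (1 + r)) \<longlonglongrightarrow> Re (\<Phi> (Ln 1))" .
    qed (use nonneg in auto)
    then show ?thesis by (simp add: zero_ereal_def)
  qed
  show int: "set_integrable lborel {0<..} (\<lambda>r. of_real (\<mu> r) / (p + of_real r))"
  proof -
    obtain C where C: "C > 0" "\<And>r. r > 0 \<Longrightarrow> norm (1 / (p + of_real r)) \<le> C / (1 + r)"
      using cut_kernel_bound[OF p] by blast
    have "set_integrable lborel {0<..} (\<lambda>r. C * (\<mu> r / (1 + r)))"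
      using int1 by (rule set_integrable_mult_right)
    then show ?thesis
    proof (rule set_integrable_bound)
      show "set_borel_measurable lborel {0<..} (\<lambda>r. of_real (\<mu> r) / (p + of_real r))"
        using set_measurable_continuous_on[OF _ contk[OF p]] by (simp add: set_borel_measurable_def)
      show "AE r in lborel. r \<in> {0<..} \<longrightarrow> norm (of_real (\<mu> r) / (p + of_real r)) \<le> norm (C * (\<mu> r / (1 + r)))"
      proof (intro AE_I2 impI)
        fix r :: real assume "r \<in> {0<..}"
        then have r: "r > 0" by simp
        have "norm (of_real (\<mu> r) / (p + of_real r)) = \<mu> r * norm (1 / (p + of_real r))"
          using nonneg[OF r] by (simp add: norm_divide)
        also have "\<dots> \<le> \<mu> r * (C / (1 + r))"
          by (intro mult_left_mono C nonneg r)
        also have "\<dots> = norm (C * (\<mu> r / (1 + r)))"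
          using nonneg[OF r] r C by (simp add: abs_mult)
        finally show "norm (of_real (\<mu> r) / (p + of_real r)) \<le> norm (C * (\<mu> r / (1 + r)))" .
      qed
    qed
  qed
  \<comment> \<open>With integrability known, the same truncations converge to the full integral,
    and uniqueness of limits identifies its value.\<close>
  have "(\<lambda>i. LBINT r=l i..u i. of_real (\<mu> r) / (p + of_real r)) \<longlonglongrightarrow> (LBINT r=0..\<infinity>. of_real (\<mu> r) / (p + of_real r))"
    by (rule interval_integral_Icc_approx_integrable[OF _ approx]) (use int in \<open>auto simp: zero_ereal_def\<close>)
  then have "(LBINT r=0..\<infinity>. of_real (\<mu> r) / (p + of_real r)) = \<Phi> (Ln p)"
    using lim[OF p] by (rule LIMSEQ_unique)
  then show "(LINT r:{0<..}|lborel. of_real (\<mu> r) / (p + of_real r)) = \<Phi> (Ln p)"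
    by (simp add: interval_lebesgue_integral_0_infty)
qed

section \<open>The bracket of the model in the logarithmic variable\<close>

text \<open>At \<open>z = Ln p\<close> with p nonzero and \<tau> > 0 this is
  \<open>1 + (\<tau> p)^\<alpha>\<close>. Writing the power as an exponential gives an entire
  function of \<open>z\<close>, so it continues across the edges |Im z| = pi.\<close>

definition log_base :: "real \<Rightarrow> real \<Rightarrow> complex \<Rightarrow> complex" where
  "log_base \<tau> \<alpha> z = 1 + exp (of_real \<alpha> * (of_real (ln \<tau>) + z))"

definition log_bracket :: "real \<Rightarrow> real \<Rightarrow> real \<Rightarrow> real \<Rightarrow> complex \<Rightarrow> complex" where
  "log_bracket b \<tau> \<alpha> \<gamma> z = 1 - of_real b / log_base \<tau> \<alpha> z powr of_real \<gamma>"

lemma hn_bracket_eq_log_bracket: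
  assumes "\<tau> > 0" "p \<noteq> 0"
  shows "hn_bracket b \<tau> \<alpha> \<gamma> p = log_bracket b \<tau> \<alpha> \<gamma> (Ln p)"
  using assms by (simp add: hn_bracket_def log_bracket_def log_base_def powr_def[of "of_real \<tau> * p"] Ln_times_of_real
      flip: Ln_of_real)

lemma Im_log_base: "Im (log_base \<tau> \<alpha> z) = exp (\<alpha> * (ln \<tau> + Re z)) * sin (\<alpha> * Im z)"
  by (simp add: log_base_def Im_exp)

lemma Im_log_base_pos:
  assumes "0 < \<alpha>" "0 < Im z" "Im z < pi / \<alpha>"
  shows "Im (log_base \<tau> \<alpha> z) > 0"
  using assms unfolding Im_log_base
  by (intro mult_pos_pos sin_gt_zero) (auto simp: field_simps)

lemma log_base_real:
  assumes "Im z = 0"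
  shows "log_base \<tau> \<alpha> z = of_real (1 + exp (\<alpha> * (ln \<tau> + Re z)))"
  using assms by (simp add: log_base_def complex_eq_iff Re_exp Im_exp)

lemma log_base_cnj: "log_base \<tau> \<alpha> (cnj z) = cnj (log_base \<tau> \<alpha> z)"
  by (simp add: log_base_def exp_cnj)

text \<open>For 0 < Im z < pi/\<alpha> the angle \<open>\<alpha> * Im z\<close> lies in (0, pi), so
  the imaginary part is positive; conjugation covers the lower half, and real points give values
  above 1.\<close>

lemma log_base_notin_nonpos_Reals:
  assumes "0 < \<alpha>" "\<bar>Im z\<bar> < pi / \<alpha>"
  shows "log_base \<tau> \<alpha> z \<notin> \<real>\<^sub>\<le>\<^sub>0"
proof (cases "Im z" "0::real" rule: linorder_cases)
  case less
  then have "Im (log_base \<tau> \<alpha> (cnj z)) > 0" using assms by (intro Im_log_base_pos) auto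
  then show ?thesis by (auto simp: log_base_cnj complex_nonpos_Reals_iff)
next
  case equal
  then have "Re (log_base \<tau> \<alpha> z) > 0" by (simp add: log_base_real add_pos_pos)
  then show ?thesis by (auto simp: complex_nonpos_Reals_iff)
next
  case greater
  then show ?thesis
    using Im_log_base_pos[of \<alpha> z \<tau>] assms by (auto simp: complex_nonpos_Reals_iff)
qed

text \<open>Serves twice: for the sign of the imaginary part of the bracket, and for its explicit
  boundary value in terms of \<open>hn_g\<close> and \<open>hn_f\<close>.\<close>

lemma inverse_powr_polar:
  fixes M :: complex
  assumes "M \<noteq> 0"
  shows "inverse (M powr of_real \<gamma>) = of_real (1 / cmod M powr \<gamma>) * cis (- (\<gamma> * Arg M))"
proof -
  have "inverse (M powr of_real \<gamma>) = exp (- (of_real \<gamma> * Ln M))"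
    using assms by (simp add: powr_def exp_minus)
  also have "\<dots> = of_real (exp (- (\<gamma> * ln (cmod M)))) * cis (- (\<gamma> * Arg M))"
    using assms by (simp add: exp_eq_polar Arg_def)
  finally show ?thesis using assms by (simp add: powr_def exp_minus inverse_eq_divide)
qed

text \<open>The angle \<open>\<gamma> * Arg M\<close> stays in (0, pi) because \<gamma> \<le> 1.
  Thus the inverse power lies in the lower half-plane, and subtracting a positive multiple of it
  from 1 leads into the upper one.\<close>

lemma Im_bracket_pos:
  assumes "Im M > 0" "0 < b" "0 < \<gamma>" "\<gamma> \<le> 1"
  shows "Im (1 - of_real b / M powr of_real \<gamma>) > 0"
proof -
  have A: "0 < Arg M" "Arg M < pi" using assms Arg_lt_pi by auto
  have M: "M \<noteq> 0" using assms by auto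
  have "\<gamma> * Arg M \<le> 1 * Arg M" using A assms by (intro mult_right_mono) auto
  then have "0 < sin (\<gamma> * Arg M)" using A assms by (intro sin_gt_zero mult_pos_pos) linarith+
  then show ?thesis
    using assms M by (auto simp: divide_inverse[of "of_real b"] inverse_powr_polar)
qed

lemma log_bracket_cnj:
  assumes "0 < \<alpha>" "\<bar>Im z\<bar> < pi / \<alpha>"
  shows "log_bracket b \<tau> \<alpha> \<gamma> (cnj z) = cnj (log_bracket b \<tau> \<alpha> \<gamma> z)"
  using log_base_notin_nonpos_Reals[OF assms, of \<tau>]
  by (auto simp: log_bracket_def log_base_cnj cnj_powr complex_nonpos_Reals_iff)

lemma Im_log_bracket_pos:
  assumes "0 < \<alpha>" "0 < b" "0 < \<gamma>" "\<gamma> \<le> 1" "0 < Im z" "Im z < pi / \<alpha>"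
  shows "Im (log_bracket b \<tau> \<alpha> \<gamma> z) > 0"
  unfolding log_bracket_def by (intro Im_bracket_pos Im_log_base_pos assms)

text \<open>Off the real axis the imaginary part is nonzero. On it the base exceeds 1, so its
  \<gamma>-th power strictly exceeds 1 and the bracket is positive even for b = 1.\<close>

lemma log_bracket_notin_nonpos_Reals:
  assumes "0 < \<alpha>" "0 < b" "b \<le> 1" "0 < \<gamma>" "\<gamma> \<le> 1" "\<bar>Im z\<bar> < pi / \<alpha>"
  shows "log_bracket b \<tau> \<alpha> \<gamma> z \<notin> \<real>\<^sub>\<le>\<^sub>0"
proof (cases "Im z" "0::real" rule: linorder_cases)
  case less
  then have "Im (log_bracket b \<tau> \<alpha> \<gamma> (cnj z)) > 0" using assms by (intro Im_log_bracket_pos) auto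
  then show ?thesis using assms by (auto simp: log_bracket_cnj complex_nonpos_Reals_iff)
next
  case equal
  define x where "x = (1 + exp (\<alpha> * (ln \<tau> + Re z))) powr \<gamma>"
  have "x > 1" using assms by (simp add: x_def add_pos_pos)
  then have "b / x < 1" using assms by (simp add: field_simps)
  moreover have "log_bracket b \<tau> \<alpha> \<gamma> z = of_real (1 - b / x)"
    using equal powr_of_real[of "1 + exp (\<alpha> * (ln \<tau> + Re z))" \<gamma>]
    by (simp add: log_bracket_def log_base_real x_def)
  ultimately show ?thesis by (simp add: complex_nonpos_Reals_iff)
next
  case greater
  then show ?thesis
    using Im_log_bracket_pos[of \<alpha> b \<gamma> z \<tau>] assms by (auto simp: complex_nonpos_Reals_iff)
qed

section \<open>The function to be represented and its behaviour at both ends\<close>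

text \<open>At \<open>z = Ln p\<close> this is \<open>c * \<kappa>(p) / p - 1\<close>, the part of
  the wave number that the integral has to reproduce.\<close>

definition log_phi :: "real \<Rightarrow> real \<Rightarrow> real \<Rightarrow> real \<Rightarrow> complex \<Rightarrow> complex" where
  "log_phi b \<tau> \<alpha> \<gamma> z = log_bracket b \<tau> \<alpha> \<gamma> z powr (- 1 / 2) - 1"

lemma log_phi_holomorphic:
  assumes "0 < \<alpha>" "0 < b" "b \<le> 1" "0 < \<gamma>" "\<gamma> \<le> 1"
  shows "log_phi b \<tau> \<alpha> \<gamma> holomorphic_on {z. \<bar>Im z\<bar> < pi / \<alpha>}"
proof -
  have 0: "log_base \<tau> \<alpha> holomorphic_on {z. \<bar>Im z\<bar> < pi / \<alpha>}"
    unfolding log_base_def by (intro holomorphic_intros)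
  have nz: "log_base \<tau> \<alpha> z \<noteq> 0" if "\<bar>Im z\<bar> < pi / \<alpha>" for z
    using log_base_notin_nonpos_Reals[OF assms(1) that, of \<tau>] by auto
  have "log_bracket b \<tau> \<alpha> \<gamma> holomorphic_on {z. \<bar>Im z\<bar> < pi / \<alpha>}"
    unfolding log_bracket_def
    by (intro holomorphic_intros 0) (use log_base_notin_nonpos_Reals assms nz in auto)
  then show ?thesis
    unfolding log_phi_def
    by (intro holomorphic_intros) (use log_bracket_notin_nonpos_Reals assms in auto)
qed

lemma log_phi_cnj:
  assumes "0 < \<alpha>" "0 < b" "b \<le> 1" "0 < \<gamma>" "\<gamma> \<le> 1" "\<bar>Im z\<bar> < pi / \<alpha>"
  shows "log_phi b \<tau> \<alpha> \<gamma> (cnj z) = cnj (log_phi b \<tau> \<alpha> \<gamma> z)"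
  using log_bracket_notin_nonpos_Reals[OF assms, of \<tau>] assms
  by (auto simp: log_phi_def log_bracket_cnj cnj_powr complex_nonpos_Reals_iff)

text \<open>The base grows without bound, so the bracket tends to 1. Only moduli enter the
  estimates, and these are controlled by \<open>Re z\<close> alone, so no restriction on
  \<open>Im z\<close> appears in the filter.\<close>

lemma log_phi_right:
  assumes "0 < \<alpha>" "0 < \<gamma>"
  shows "(log_phi b \<tau> \<alpha> \<gamma> \<longlongrightarrow> 0) (filtercomap Re at_top)"
proof -
  let ?F = "filtercomap Re at_top"
  have powr_at_top: "filterlim (\<lambda>x. x powr \<gamma>) at_top at_top"
  proof -
    have "filterlim (\<lambda>x. exp (\<gamma> * ln x)) at_top at_top"
      by (intro filterlim_compose[OF exp_at_top] ln_at_top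
          filterlim_tendsto_pos_mult_at_top[OF tendsto_const assms(2)])
    moreover have "\<forall>\<^sub>F x in at_top. exp (\<gamma> * ln x) = x powr \<gamma>"
      using eventually_gt_at_top[of 0] by eventually_elim (simp add: powr_def)
    ultimately show ?thesis by (simp add: filterlim_cong)
  qed
  have "filterlim (\<lambda>z. \<alpha> * (ln \<tau> + Re z)) at_top ?F"
    by (intro filterlim_tendsto_pos_mult_at_top[OF tendsto_const assms(1)]
        filterlim_tendsto_add_at_top[OF tendsto_const] filterlim_filtercomap)
  then have "filterlim (\<lambda>z. cmod (exp (of_real \<alpha> * (of_real (ln \<tau>) + z)))) at_top ?F"
    by (simp add: norm_exp_eq_Re filterlim_compose[OF exp_at_top])
  then have "filterlim (\<lambda>z. exp (of_real \<alpha> * (of_real (ln \<tau>) + z))) at_infinity ?F"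
    by (rule filterlim_norm_at_top_imp_at_infinity)
  then have "filterlim (log_base \<tau> \<alpha>) at_infinity ?F"
    unfolding log_base_def by (rule tendsto_add_filterlim_at_infinity[OF tendsto_const])
  then have "filterlim (\<lambda>z. cmod (log_base \<tau> \<alpha> z)) at_top ?F"
    by (rule filterlim_at_infinity_imp_norm_at_top)
  then have "filterlim (\<lambda>z. cmod (log_base \<tau> \<alpha> z powr of_real \<gamma>)) at_top ?F"
    using filterlim_compose[OF powr_at_top] assms(2) by (simp add: norm_powr_real_powr')
  then have "filterlim (\<lambda>z. log_base \<tau> \<alpha> z powr of_real \<gamma>) at_infinity ?F"
    by (rule filterlim_norm_at_top_imp_at_infinity)
  then have "(log_bracket b \<tau> \<alpha> \<gamma> \<longlongrightarrow> 1 - 0) ?F"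
    unfolding log_bracket_def by (intro tendsto_intros tendsto_divide_0[OF tendsto_const])
  then have "(log_phi b \<tau> \<alpha> \<gamma> \<longlongrightarrow> 1 powr (-1/2) - 1) ?F"
    unfolding log_phi_def by (intro tendsto_intros) auto
  then show ?thesis by simp
qed

text \<open>For b < 1 the bracket tends to 1 - b > 0 and its inverse root stays bounded. For b = 1
  the bracket vanishes like \<open>\<gamma> * s z\<close>, so its inverse root grows like
  \<open>exp (- \<alpha> * Re z / 2)\<close>, which the factor \<open>exp z\<close>
  dominates.\<close>

lemma log_phi_left:
  assumes "0 < \<alpha>" "\<alpha> < 1" "0 < \<gamma>" "b \<le> 1"
  shows "((\<lambda>z. exp z * log_phi b \<tau> \<alpha> \<gamma> z) \<longlongrightarrow> 0) (filtercomap Re at_bot)"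
proof -
  let ?F = "filtercomap Re at_bot"
  define s where "s = (\<lambda>z::complex. exp (of_real \<alpha> * (of_real (ln \<tau>) + z)))"
  have F: "filterlim Re at_bot ?F" by (rule filterlim_filtercomap)
  have "filterlim (\<lambda>z. \<alpha> * (ln \<tau> + Re z)) at_bot ?F"
    by (intro filterlim_tendsto_pos_mult_at_bot[OF tendsto_const assms(1)]
        filterlim_tendsto_add_at_bot_iff[OF tendsto_const, THEN iffD2] F)
  then have "((\<lambda>z. cmod (s z)) \<longlongrightarrow> 0) ?F"
    by (simp add: s_def norm_exp_eq_Re filterlim_compose[OF exp_at_bot])
  then have s0: "(s \<longlongrightarrow> 0) ?F" by (rule tendsto_norm_zero_cancel)
  have "((\<lambda>z. cmod (exp z)) \<longlongrightarrow> 0) ?F"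
    unfolding norm_exp_eq_Re by (rule filterlim_compose[OF exp_at_bot F])
  then have e0: "(exp \<longlongrightarrow> (0::complex)) ?F" by (rule tendsto_norm_zero_cancel)
  have "((\<lambda>z. exp z * log_bracket b \<tau> \<alpha> \<gamma> z powr (-1/2)) \<longlongrightarrow> 0) ?F"
  proof (cases "b = 1")
    case False
    have "(log_bracket b \<tau> \<alpha> \<gamma> \<longlongrightarrow> 1 - of_real b / (1 + 0) powr of_real \<gamma>) ?F"
      unfolding log_bracket_def log_base_def using s0[unfolded s_def]
      by (intro tendsto_intros) auto
    then have "((\<lambda>z. exp z * log_bracket b \<tau> \<alpha> \<gamma> z powr (-1/2)) \<longlongrightarrow> 0 * of_real (1 - b) powr (-1/2)) ?F"
      using False assms by (intro tendsto_intros e0) (auto simp: complex_nonpos_Reals_iff)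
    then show ?thesis by simp
  next
    case True
    \<comment> \<open>A difference quotient at 0 with limit \<gamma>; it factors the bracket as
      \<open>s z * D (s z)\<close> with a second factor that does not vanish in the limit.\<close>
    define D where "D = (\<lambda>w::complex. (1 - 1 / (1 + w) powr of_real \<gamma>) / w)"
    have "((\<lambda>w::complex. 1 - 1 / (1 + w) powr of_real \<gamma>) has_field_derivative of_real \<gamma>) (at 0)"
      by (auto intro!: derivative_eq_intros simp: powr_diff)
    then have "(D \<longlongrightarrow> of_real \<gamma>) (at 0)"
      by (simp add: D_def has_field_derivative_iff)
    moreover have "filterlim s (at 0) ?F"
      using s0 by (simp add: filterlim_at s_def)
    ultimately have "((\<lambda>z. D (s z)) \<longlongrightarrow> of_real \<gamma>) ?F"
      by (rule filterlim_compose)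
    \<comment> \<open>Moduli suffice for a limit 0, and real powers of moduli factor without branch
      conditions, unlike principal complex powers.\<close>
    then have "((\<lambda>z. cmod (D (s z)) powr (-1/2)) \<longlongrightarrow> \<gamma> powr (-1/2)) ?F"
      using assms by (intro tendsto_powr) (auto dest: tendsto_norm)
    moreover have "((\<lambda>z. cmod (exp z) * cmod (s z) powr (-1/2)) \<longlongrightarrow> 0) ?F"
    proof -
      have eq: "cmod (exp z) * cmod (s z) powr (-1/2) = exp (- (\<alpha> * ln \<tau> / 2) + (1 - \<alpha> / 2) * Re z)" for z
        by (simp add: s_def norm_exp_eq_Re powr_def algebra_simps flip: exp_add)
      have "1 - \<alpha> / 2 > 0" using assms by simp
      then have "filterlim (\<lambda>z. - (\<alpha> * ln \<tau> / 2) + (1 - \<alpha> / 2) * Re z) at_bot ?F"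
        by (intro filterlim_tendsto_add_at_bot_iff[OF tendsto_const, THEN iffD2]
          filterlim_tendsto_pos_mult_at_bot[OF tendsto_const] F)
      then show ?thesis
        unfolding eq by (rule filterlim_compose[OF exp_at_bot])
    qed
    ultimately have "((\<lambda>z. (cmod (exp z) * cmod (s z) powr (-1/2)) * cmod (D (s z)) powr (-1/2)) \<longlongrightarrow> 0 * \<gamma> powr (-1/2)) ?F"
      by (intro tendsto_mult)
    also have "(\<lambda>z. (cmod (exp z) * cmod (s z) powr (-1/2)) * cmod (D (s z)) powr (-1/2)) =
      (\<lambda>z. cmod (exp z * log_bracket b \<tau> \<alpha> \<gamma> z powr (-1/2)))"
    proof
      fix z
      have "s z \<noteq> 0" by (simp add: s_def)
      then have "log_bracket b \<tau> \<alpha> \<gamma> z = s z * D (s z)"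
        using True by (simp add: D_def log_bracket_def log_base_def s_def)
      then show "(cmod (exp z) * cmod (s z) powr (-1/2)) * cmod (D (s z)) powr (-1/2) = cmod (exp z * log_bracket b \<tau> \<alpha> \<gamma> z powr (-1/2))"
        using norm_powr_real_powr'[of "-1/2" "log_bracket b \<tau> \<alpha> \<gamma> z"]
        by (simp add: norm_mult powr_mult)
    qed
    finally show ?thesis by (simp add: tendsto_norm_zero_cancel)
  qed
  then have "((\<lambda>z. exp z * log_bracket b \<tau> \<alpha> \<gamma> z powr (-1/2) - exp z) \<longlongrightarrow> 0 - 0) ?F"
    by (intro tendsto_diff e0)
  then show ?thesis by (simp add: log_phi_def algebra_simps)
qed

section \<open>The spectral density\<close>

lemma powr_minus_half: "z powr - (1 / 2) = 1 / csqrt z" for z :: complex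
  by (simp add: csqrt_conv_powr powr_minus inverse_eq_divide)

text \<open>Since \<open>1 / csqrt z\<close> is the conjugate of \<open>csqrt z\<close> divided by
  \<open>cmod z\<close>, the half-angle formula for the imaginary part of the root applies. This is
  the origin of the square root and the quotient in \<open>hn_h\<close>.\<close>

lemma Im_powr_minus_half:
  fixes z :: complex
  assumes "Im z > 0"
  shows "Im (z powr - (1 / 2)) = - sqrt ((cmod z - Re z) / 2) / cmod z"
proof -
  have "(cmod (csqrt z))\<^sup>2 = cmod z"
    by (metis norm_power power2_csqrt)
  then have "Im (1 / csqrt z) = - Im (csqrt z) / cmod z"
    by (simp add: Im_divide del: csqrt.simps flip: cmod_power2)
  also have "Im (csqrt z) = sqrt ((cmod z - Re z) / 2)"
    using assms by simp
  finally show ?thesis by (simp add: powr_minus_half)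
qed

text \<open>The point \<open>Complex (ln r) pi\<close> is the logarithm of -r on the upper side of
  the cut, so the base there is the number whose argument defines \<open>hn_f\<close>.\<close>

lemma log_base_upper_edge:
  assumes "\<tau> > 0" "r > 0"
  shows "log_base \<tau> \<alpha> (Complex (ln r) pi) = 1 + of_real ((\<tau> * r) powr \<alpha>) * exp (\<i> * of_real (pi * \<alpha>))"
proof -
  have "of_real \<alpha> * (of_real (ln \<tau>) + Complex (ln r) pi) = of_real (\<alpha> * ln (\<tau> * r)) + \<i> * of_real (pi * \<alpha>)"
    using assms by (simp add: complex_eq_iff ln_mult)
  then have "log_base \<tau> \<alpha> (Complex (ln r) pi) =
      1 + of_real (exp (\<alpha> * ln (\<tau> * r))) * exp (\<i> * of_real (pi * \<alpha>))"
    by (simp only: log_base_def exp_add exp_of_real)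
  then show ?thesis
    using assms by (simp add: powr_def)
qed

context
  fixes \<tau> \<alpha> r :: real
  assumes \<tau>: "\<tau> > 0" and \<alpha>: "0 < \<alpha>" "\<alpha> < 1" and r: "r > 0"
begin

lemma hn_f_eq: "hn_f \<tau> \<alpha> r = Arg (log_base \<tau> \<alpha> (Complex (ln r) pi))"
  using \<tau> r by (simp add: hn_f_def log_base_upper_edge)

lemma Im_log_base_upper_edge: "Im (log_base \<tau> \<alpha> (Complex (ln r) pi)) > 0"
  using \<alpha> by (intro Im_log_base_pos) (auto simp: field_simps)

lemma hn_f_bounds: "hn_f \<tau> \<alpha> r \<in> {0<..<pi}"
  using Im_log_base_upper_edge Arg_lt_pi by (auto simp: hn_f_eq)

lemma hn_g_eq: "hn_g \<tau> \<alpha> \<gamma> r = cmod (log_base \<tau> \<alpha> (Complex (ln r) pi)) powr \<gamma>"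
proof -
  define s where "s = (\<tau> * r) powr \<alpha>"
  let ?M = "log_base \<tau> \<alpha> (Complex (ln r) pi)"
  have "?M = Complex (1 + s * cos (pi * \<alpha>)) (s * sin (pi * \<alpha>))"
    using \<tau> r by (simp add: log_base_upper_edge s_def exp_eq_polar complex_eq_iff)
  moreover have "(1 + s * x)\<^sup>2 + (s * y)\<^sup>2 = 1 + 2 * s * x + s\<^sup>2 * (y\<^sup>2 + x\<^sup>2)" for x y
    by (simp add: power2_eq_square algebra_simps)
  ultimately have "(cmod ?M)\<^sup>2 = 1 + 2 * s * cos (pi * \<alpha>) + s\<^sup>2"
    by (simp add: cmod_power2)
  also have "\<dots> = 1 + 2 * (\<tau> * r) powr \<alpha> * cos (pi * \<alpha>) + (\<tau> * r) powr (2 * \<alpha>)"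
    by (simp add: s_def power2_eq_square flip: powr_add)
  finally have "hn_g \<tau> \<alpha> \<gamma> r = (cmod ?M)\<^sup>2 powr (\<gamma> / 2)" by (simp add: hn_g_def)
  also have "\<dots> = cmod ?M powr \<gamma>"
    by (simp add: powr_powr flip: powr_numeral)
  finally show ?thesis .
qed

text \<open>The inverse power has modulus \<open>1 / G\<close> and angle \<open>- \<theta>\<close>,
  which accounts for the two opposite signs.\<close>

lemma log_bracket_upper_edge:
  fixes b \<gamma> :: real
  defines "G \<equiv> hn_g \<tau> \<alpha> \<gamma> r" and "\<theta> \<equiv> \<gamma> * hn_f \<tau> \<alpha> r"
  shows "log_bracket b \<tau> \<alpha> \<gamma> (Complex (ln r) pi) = Complex (1 - b * cos \<theta> / G) (b * sin \<theta> / G)"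
proof -
  have "log_base \<tau> \<alpha> (Complex (ln r) pi) \<noteq> 0" using Im_log_base_upper_edge by auto
  from inverse_powr_polar[OF this, of \<gamma>] show ?thesis
    by (simp add: log_bracket_def divide_inverse[of "of_real b"] G_def \<theta>_def hn_g_eq hn_f_eq complex_eq_iff)
qed

text \<open>Expanding the squared modulus of the boundary value and using
  \<open>sin\<^sup>2 + cos\<^sup>2 = 1\<close> gives the radicand of \<open>hn_k\<close>.\<close>

lemma hn_k_eq: "hn_k b \<tau> \<alpha> \<gamma> r = cmod (log_bracket b \<tau> \<alpha> \<gamma> (Complex (ln r) pi))"
proof -
  define G \<theta> where "G = hn_g \<tau> \<alpha> \<gamma> r" and "\<theta> = \<gamma> * hn_f \<tau> \<alpha> r"
  have "(1 - b * x / G)\<^sup>2 + (b * y / G)\<^sup>2 = 1 - 2 * b * x / G + b\<^sup>2 / G\<^sup>2 * (y\<^sup>2 + x\<^sup>2)" for x y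
    by (simp add: power2_eq_square add_divide_distrib diff_divide_distrib algebra_simps)
  from this[of "cos \<theta>" "sin \<theta>"]
  have "(1 - b * cos \<theta> / G)\<^sup>2 + (b * sin \<theta> / G)\<^sup>2 = 1 + b\<^sup>2 / G\<^sup>2 - 2 * b * cos \<theta> / G"
    by simp
  then show ?thesis
    by (simp add: log_bracket_upper_edge cmod_def hn_k_def G_def \<theta>_def)
qed

text \<open>With B the boundary value of the bracket, the radicand in \<open>hn_h\<close> is |B| -
  Re B and the denominator is |B|. The factor \<open>c\<close> cancels the one in the normalization
  of \<open>hn_h\<close>.\<close>

lemma hn_h_eq_jump:
  assumes "c > 0" "0 < b" "0 < \<gamma>" "\<gamma> \<le> 1"
  shows "c * hn_h c b \<tau> \<alpha> \<gamma> r = - Im (log_phi b \<tau> \<alpha> \<gamma> (Complex (ln r) pi)) / pi"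
proof -
  let ?B = "log_bracket b \<tau> \<alpha> \<gamma> (Complex (ln r) pi)"
  have "Im ?B > 0"
    using \<alpha> assms by (intro Im_log_bracket_pos) (auto simp: field_simps)
  then have "- Im (log_phi b \<tau> \<alpha> \<gamma> (Complex (ln r) pi)) / pi = sqrt ((cmod ?B - Re ?B) / 2) / cmod ?B / pi"
    by (simp add: log_phi_def Im_powr_minus_half)
  also have "Re ?B = 1 - b * cos (\<gamma> * hn_f \<tau> \<alpha> r) / hn_g \<tau> \<alpha> \<gamma> r"
    by (simp add: log_bracket_upper_edge)
  also have "cmod ?B = hn_k b \<tau> \<alpha> \<gamma> r" by (simp add: hn_k_eq)
  finally show ?thesis
    using assms by (simp add: hn_h_def real_sqrt_divide diff_diff_eq2 add_diff_eq diff_add_eq mult_ac)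
qed

text \<open>\<open>sqrt\<close> takes negative values at negative reals, so the sign of the radicand
  matters; it is |B| - Re B for the boundary value B, hence nonnegative.\<close>

lemma hn_h_nonneg:
  assumes "c > 0"
  shows "hn_h c b \<tau> \<alpha> \<gamma> r \<ge> 0"
  using assms complex_Re_le_cmod[of "log_bracket b \<tau> \<alpha> \<gamma> (Complex (ln r) pi)"]
  by (simp add: hn_h_def hn_k_eq log_bracket_upper_edge)

end

section \<open>The representation of the wave number and its values on the imaginary axis\<close>

text \<open>An instance of the Stieltjes representation with
  \<open>\<Phi> = log_phi b \<tau> \<alpha> \<gamma>\<close>, d = pi/\<alpha> and density c h; here
  \<alpha> < 1 makes the strip wider than pi.\<close>

lemma hn_kappa_representation:
  assumes "c > 0" "\<tau> > 0" "0 < b" "b \<le> 1" "0 < \<alpha>" "\<alpha> < 1" "0 < \<gamma>" "\<gamma> \<le> 1"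
    and p: "p \<notin> \<real>\<^sub>\<le>\<^sub>0"
  shows "set_integrable lborel {0<..} (\<lambda>r. of_real (hn_h c b \<tau> \<alpha> \<gamma> r) / (p + of_real r))"
    and "hn_kappa c b \<tau> \<alpha> \<gamma> p =
            p / of_real c
            + p * (LINT r:{0<..}|lborel. of_real (hn_h c b \<tau> \<alpha> \<gamma> r) / (p + of_real r))"
proof -
  have d: "pi < pi / \<alpha>" using assms by (simp add: field_simps)
  have eq: "of_real (c * hn_h c b \<tau> \<alpha> \<gamma> r) / (p + of_real r) = of_real c * (of_real (hn_h c b \<tau> \<alpha> \<gamma> r) / (p + of_real r))" for r
    by simp
  \<comment> \<open>The limits at both ends were proved without a bound on \<open>Im z\<close>;
    intersecting with the strip only makes the filter finer.\<close>
  have right: "(log_phi b \<tau> \<alpha> \<gamma> \<longlongrightarrow> 0) right_end"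
    by (rule tendsto_mono[OF inf_le1 log_phi_right]) (use assms in auto)
  have left: "((\<lambda>z. exp z * log_phi b \<tau> \<alpha> \<gamma> z) \<longlongrightarrow> 0) left_end"
    by (rule tendsto_mono[OF inf_le1 log_phi_left]) (use assms in auto)
  have p0: "p \<noteq> 0" using p by auto
  note holo = log_phi_holomorphic[OF assms(5,3,4,7,8), of \<tau>]
  note cnj = log_phi_cnj[OF assms(5,3,4,7,8), of _ \<tau>]
  have \<mu>: "c * hn_h c b \<tau> \<alpha> \<gamma> r = - Im (log_phi b \<tau> \<alpha> \<gamma> (Complex (ln r) pi)) / pi" if "r > 0" for r
    using that assms by (intro hn_h_eq_jump)
  have nonneg: "c * hn_h c b \<tau> \<alpha> \<gamma> r \<ge> 0" if "r > 0" for r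
    using that assms by (intro mult_nonneg_nonneg hn_h_nonneg) auto
  note R = Stieltjes_representation[OF d holo cnj right left \<mu> nonneg p]
  have "set_integrable lborel {0<..} (\<lambda>r. of_real (c * hn_h c b \<tau> \<alpha> \<gamma> r) / (p + of_real r))"
    by (rule R(1))
  then show "set_integrable lborel {0<..} (\<lambda>r. of_real (hn_h c b \<tau> \<alpha> \<gamma> r) / (p + of_real r))"
    unfolding eq using assms(1) by (subst (asm) set_integrable_mult_right_iff) auto
  have "(LINT r:{0<..}|lborel. of_real (c * hn_h c b \<tau> \<alpha> \<gamma> r) / (p + of_real r)) = log_phi b \<tau> \<alpha> \<gamma> (Ln p)"
    by (rule R(2))
  then have cI: "of_real c * (LINT r:{0<..}|lborel. of_real (hn_h c b \<tau> \<alpha> \<gamma> r) / (p + of_real r)) = log_phi b \<tau> \<alpha> \<gamma> (Ln p)"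
    unfolding eq set_integral_mult_right .
  have "hn_kappa c b \<tau> \<alpha> \<gamma> p = p / of_real c * (1 + log_phi b \<tau> \<alpha> \<gamma> (Ln p))"
    using hn_bracket_eq_log_bracket[OF assms(2) p0] by (simp add: hn_kappa_def log_phi_def)
  then show "hn_kappa c b \<tau> \<alpha> \<gamma> p =
            p / of_real c
            + p * (LINT r:{0<..}|lborel. of_real (hn_h c b \<tau> \<alpha> \<gamma> r) / (p + of_real r))"
    using assms(1) by (simp add: field_simps flip: cI)
qed

text \<open>The factor p cancels in the complex modulus, and the positive factor \<open>G0\<close>
  leaves the principal root without changing the branch.\<close>

lemma wave_number_hn_modulus:
  assumes "\<rho> > 0" "G0 > 0" "c = sqrt (G0 / \<rho>)" "p \<noteq> 0"
  shows "wave_number \<rho> (hn_modulus_LT G0 b \<tau> \<alpha> \<gamma>) p = hn_kappa c b \<tau> \<alpha> \<gamma> p"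
proof -
  have "complex_modulus (hn_modulus_LT G0 b \<tau> \<alpha> \<gamma>) p = of_real G0 * hn_bracket b \<tau> \<alpha> \<gamma> p"
    using assms by (simp add: complex_modulus_def hn_modulus_LT_def)
  moreover have "csqrt (of_real G0 * z) = of_real (sqrt G0) * csqrt z" for z
    using assms by (subst csqrt_mult) (auto simp: csqrt_of_real Arg_le_pi mpi_less_Arg)
  ultimately show ?thesis
    using assms by (simp add: wave_number_def hn_kappa_def powr_minus_half real_sqrt_divide)
qed

lemma set_integrable_Re_Im:
  fixes f :: "'a \<Rightarrow> complex"
  assumes "set_integrable M A f"
  shows "set_integrable M A (\<lambda>x. Re (f x))" "(LINT x:A|M. Re (f x)) = Re (LINT x:A|M. f x)"
    "set_integrable M A (\<lambda>x. Im (f x))" "(LINT x:A|M. Im (f x)) = Im (LINT x:A|M. f x)"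
proof -
  have "integrable M (\<lambda>x. indicator A x *\<^sub>R f x)" using assms by (simp add: set_integrable_def)
  from integrable_Re[OF this] integral_Re[OF this] integrable_Im[OF this] integral_Im[OF this]
  show "set_integrable M A (\<lambda>x. Re (f x))" "(LINT x:A|M. Re (f x)) = Re (LINT x:A|M. f x)"
    "set_integrable M A (\<lambda>x. Im (f x))" "(LINT x:A|M. Im (f x)) = Im (LINT x:A|M. f x)"
    by (simp_all add: set_integrable_def set_lebesgue_integral_def)
qed

text \<open>Since \<open>1 / (r - \<i> * \<omega>) = (r + \<i> * \<omega>) / (r\<^sup>2 +
  \<omega>\<^sup>2)\<close>, the two real integrals are, up to a factor \<omega>, the imaginary and
  real parts of the complex one; multiplication by \<open>- \<i> * \<omega>\<close> exchanges their
  roles.\<close>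

lemma attenuation_dispersion_of_representation:
  fixes h :: "real \<Rightarrow> real"
  assumes "\<omega> \<noteq> 0"
    and int: "set_integrable lborel {0<..} (\<lambda>r. of_real (h r) / (- \<i> * of_real \<omega> + of_real r))"
    and rep: "\<kappa> (- \<i> * of_real \<omega>) = - \<i> * of_real \<omega> / of_real c
       + - \<i> * of_real \<omega> * (LINT r:{0<..}|lborel. of_real (h r) / (- \<i> * of_real \<omega> + of_real r))"
  shows "set_integrable lborel {0<..} (\<lambda>r. h r / (r\<^sup>2 + \<omega>\<^sup>2))"
    and "attenuation c \<kappa> \<omega> = \<omega>\<^sup>2 * (LINT r:{0<..}|lborel. h r / (r\<^sup>2 + \<omega>\<^sup>2))"
    and "set_integrable lborel {0<..} (\<lambda>r. r * h r / (r\<^sup>2 + \<omega>\<^sup>2))"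
    and "dispersion c \<kappa> \<omega> = \<omega> * (LINT r:{0<..}|lborel. r * h r / (r\<^sup>2 + \<omega>\<^sup>2))"
proof -
  let ?I = "LINT r:{0<..}|lborel. of_real (h r) / (- \<i> * of_real \<omega> + of_real r)"
  have Re: "Re (of_real (h r) / (- \<i> * of_real \<omega> + of_real r)) = r * h r / (r\<^sup>2 + \<omega>\<^sup>2)" for r
    by (simp add: Re_divide)
  have Im: "Im (of_real (h r) / (- \<i> * of_real \<omega> + of_real r)) = \<omega> * (h r / (r\<^sup>2 + \<omega>\<^sup>2))" for r
    by (simp add: Im_divide)
  note RI = set_integrable_Re_Im[OF int, unfolded Re Im]
  show "set_integrable lborel {0<..} (\<lambda>r. h r / (r\<^sup>2 + \<omega>\<^sup>2))"
    \<comment> \<open>The imaginary part carries an extra factor \<omega>, removed because it is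
      nonzero.\<close>
    using RI(3) assms(1) by (subst (asm) set_integrable_mult_right_iff)
  show "set_integrable lborel {0<..} (\<lambda>r. r * h r / (r\<^sup>2 + \<omega>\<^sup>2))"
    by (rule RI(1))
  have beta: "wave_beta c \<kappa> (- \<i> * of_real \<omega>) = - \<i> * of_real \<omega> * ?I"
    unfolding wave_beta_def rep by simp
  have Im_I: "Im ?I = \<omega> * (LINT r:{0<..}|lborel. h r / (r\<^sup>2 + \<omega>\<^sup>2))"
    using RI(4) by (simp only: set_integral_mult_right)
  have Re_rot: "Re (- \<i> * of_real \<omega> * z) = \<omega> * Im z"
    and Im_rot: "Im (- \<i> * of_real \<omega> * z) = - \<omega> * Re z" for z
    by simp_all
  show "attenuation c \<kappa> \<omega> = \<omega>\<^sup>2 * (LINT r:{0<..}|lborel. h r / (r\<^sup>2 + \<omega>\<^sup>2))"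
    unfolding attenuation_def beta Re_rot Im_I by (simp only: power2_eq_square mult.assoc)
  show "dispersion c \<kappa> \<omega> = \<omega> * (LINT r:{0<..}|lborel. r * h r / (r\<^sup>2 + \<omega>\<^sup>2))"
    unfolding dispersion_def beta Im_rot RI(2) by simp
qed

text \<open>Integrability is asserted next to each formula because the Lebesgue integral of a
  non-integrable function is 0 by convention, so the equations alone would not express
  convergence.\<close>

theorem mainTheorem6:
  fixes \<rho> G0 \<tau> b \<alpha> \<gamma> c :: real
  assumes "\<rho> > 0" and "G0 > 0" and "\<tau> > 0"
    and "0 < b" and "b \<le> 1"
    and "0 < \<alpha>" and "\<alpha> < 1"
    and "0 < \<gamma>" and "\<gamma> \<le> 1"
    and "c = sqrt (G0 / \<rho>)"
  shows
    "(\<forall>p. p \<notin> \<real>\<^sub>\<le>\<^sub>0 \<longrightarrow>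
        wave_number \<rho> (hn_modulus_LT G0 b \<tau> \<alpha> \<gamma>) p = hn_kappa c b \<tau> \<alpha> \<gamma> p)
     \<and> (\<forall>r>0. hn_f \<tau> \<alpha> r \<in> {0<..<pi})
     \<and> (\<forall>p. p \<notin> \<real>\<^sub>\<le>\<^sub>0 \<longrightarrow>
          set_integrable lborel {0<..} (\<lambda>r. of_real (hn_h c b \<tau> \<alpha> \<gamma> r) / (p + of_real r))
        \<and> hn_kappa c b \<tau> \<alpha> \<gamma> p =
            p / of_real c
            + p * (LINT r:{0<..}|lborel. of_real (hn_h c b \<tau> \<alpha> \<gamma> r) / (p + of_real r)))
     \<and> (\<forall>\<omega>. \<omega> \<noteq> 0 \<longrightarrow>
          set_integrable lborel {0<..} (\<lambda>r. hn_h c b \<tau> \<alpha> \<gamma> r / (r\<^sup>2 + \<omega>\<^sup>2))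
        \<and> attenuation c (wave_number \<rho> (hn_modulus_LT G0 b \<tau> \<alpha> \<gamma>)) \<omega> =
            \<omega>\<^sup>2 * (LINT r:{0<..}|lborel. hn_h c b \<tau> \<alpha> \<gamma> r / (r\<^sup>2 + \<omega>\<^sup>2))
        \<and> set_integrable lborel {0<..} (\<lambda>r. r * hn_h c b \<tau> \<alpha> \<gamma> r / (r\<^sup>2 + \<omega>\<^sup>2))
        \<and> dispersion c (wave_number \<rho> (hn_modulus_LT G0 b \<tau> \<alpha> \<gamma>)) \<omega> =
            \<omega> * (LINT r:{0<..}|lborel. r * hn_h c b \<tau> \<alpha> \<gamma> r / (r\<^sup>2 + \<omega>\<^sup>2)))"
proof -
  have c: "c > 0" using assms by simp
  note wn = wave_number_hn_modulus[OF assms(1,2,10)]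
  note rep = hn_kappa_representation[OF c assms(3-9)]
  have nz: "p \<noteq> 0" if "p \<notin> \<real>\<^sub>\<le>\<^sub>0" for p :: complex using that by auto
  \<comment> \<open>A nonzero purely imaginary point is off the cut, so the attenuation and
    dispersion are read off from the representation itself, without a limit.\<close>
  have ax: "- \<i> * of_real \<omega> \<notin> \<real>\<^sub>\<le>\<^sub>0" if "\<omega> \<noteq> 0" for \<omega>
    using that by (auto simp: complex_nonpos_Reals_iff)
  have ad: "set_integrable lborel {0<..} (\<lambda>r. hn_h c b \<tau> \<alpha> \<gamma> r / (r\<^sup>2 + \<omega>\<^sup>2))
        \<and> attenuation c (wave_number \<rho> (hn_modulus_LT G0 b \<tau> \<alpha> \<gamma>)) \<omega> =
            \<omega>\<^sup>2 * (LINT r:{0<..}|lborel. hn_h c b \<tau> \<alpha> \<gamma> r / (r\<^sup>2 + \<omega>\<^sup>2))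
        \<and> set_integrable lborel {0<..} (\<lambda>r. r * hn_h c b \<tau> \<alpha> \<gamma> r / (r\<^sup>2 + \<omega>\<^sup>2))
        \<and> dispersion c (wave_number \<rho> (hn_modulus_LT G0 b \<tau> \<alpha> \<gamma>)) \<omega> =
            \<omega> * (LINT r:{0<..}|lborel. r * hn_h c b \<tau> \<alpha> \<gamma> r / (r\<^sup>2 + \<omega>\<^sup>2))"
    if \<omega>: "\<omega> \<noteq> 0" for \<omega>
  proof -
    note p = ax[OF \<omega>]
    show ?thesis
      using attenuation_dispersion_of_representation
        [where \<kappa> = "wave_number \<rho> (hn_modulus_LT G0 b \<tau> \<alpha> \<gamma>)", OF \<omega> rep(1)[OF p] trans[OF wn[OF nz[OF p]] rep(2)[OF p]]] by blast
  qed
  show ?thesis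
    using wn nz hn_f_bounds[OF assms(3,6,7)] rep ad by blast
qed

end
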